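(* (Cramer's rule, Part 2) Let $(\mathcal A,\mathcal A_0,(-))$ be a $\mathcal T$-semiring triple satisfying Condition A1, and let $A$ be an $n\times n$ matrix over $\mathcal A$. Then, for any vectors $\mathbf v\in\mathcal A^{(n)}$ and $\mathbf w\in\mathcal T_0^{(n)}$ satisfying $A\mathbf w\,\nabla_{(-)}\,\mathbf v$, we have $|A|\mathbf w\,\nabla_{(-)}\,\operatorname{adj}(A)\mathbf v$. In particular, if $|A|$ is invertible in $\mathcal T$, then $\mathbf x:=\frac1{|A|}\operatorname{adj}(A)\mathbf v$ satisfies $\mathbf w\,\nabla_{(-)}\,\mathbf x$. Moreover (with $|A|$ invertible in $\mathcal T$), if $\mathcal A$ has unique negation and $\operatorname{adj}(A)\mathbf v\in\mathcal T_0^{(n)}$, then $\mathbf x$ is the unique solution $\mathbf w\in\mathcal T_0^{(n)}$ of $A\mathbf w\,\nabla_{(-)}\,\mathbf v$.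
   Context: $\mathcal T$ is a commutative multiplicative monoid with unit $1$, $\mathcal T_0=\mathcal T\cup\{0\}$. A semiring satisfies all ring axioms except existence of additive inverses ($0$ additively neutral and multiplicatively absorbing). A $\mathcal T$-semiring triple $(\mathcal A,\mathcal A_0,(-))$ consists of a semiring $\mathcal A$ containing $\mathcal T_0$, with $\mathcal T$ a multiplicative submonoid not containing $0$ acting by multiplication and $\mathcal T_0$ spanning $(\mathcal A,+)$ (so $\mathcal A$ is commutative); an additive sub-semigroup $\mathcal A_0\ni0$ closed under multiplication by $\mathcal T$, with $\mathcal A_0\cap\mathcal T_0=\{0\}$; and a negation map $(-)$: an automorphism of $(\mathcal A,+,0)$ of order $\le2$ leaving $\mathcal T$ invariant, with $1+((-)1)\in\mathcal A_0$ and $((-)a)b=(-)(ab)=a((-)b)$ for $a\in\mathcal T$, $b\in\mathcal A$. Write $b(-)b'=b+((-)b')$. Unique negation: $a+a'\in\mathcal A_0$ with $a,a'\in\mathcal T$ implies $a'=(-)a$. Standing assumptions: for $a\in\mathcal T$, $ab\in\mathcal A_0$ implies $b\in\mathcal A_0$; $ab_1=ab_2$ implies $b_1=b_2$; and Property N: $a_1+a_2=a_1(-)a_1$ whenever $a_1,a_2\in\mathcal T$ and $a_1+a_2\in\mathcal A_0$. $b_1\nabla_{(-)}b_2$ means $b_1(-)b_2\in\mathcal A_0$; for vectors it is defined componentwise. $|A|=\sum_{\pi\in S_n}(-)^\pi a_{\pi(1),1}\cdots a_{\pi(n),n}$, with $(-)^\pi$ the identity for even $\pi$ and $(-)$ for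 odd $\pi$; a square matrix is singular if $|A|\in\mathcal A_0$. $\operatorname{adj}(A)$ has $(i,j)$ entry $(-)^{i+j}$ applied to the determinant of the matrix obtained from $A$ by deleting row $j$ and column $i$, where $(-)^k$ is the identity for $k$ even and $(-)$ for $k$ odd. Vectors $\mathbf v_i\in\mathcal A^{(n)}$ ($i\in I$) are dependent if $\sum_{i\in I'}a_i\mathbf v_i\in\mathcal A_0^{(n)}$ for some nonempty finite $I'\subseteq I$ and $a_i\in\mathcal T$; otherwise independent. Row (column) rank: the maximal number of independent rows (columns). Submatrix rank: the largest size of a nonsingular square submatrix. Condition A1: for every matrix over $\mathcal A$, the submatrix rank is at most the row rank and the column rank. *)

theory Defs
  imports "Jordan_Normal_Form.Determinant" "Jordan_Normal_Form.DL_Submatrix"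
begin

section \<open>Semiring triples\<close>

text \<open>
  The semiring is a whole type of class \<^class>\<open>comm_semiring_1\<close>. Its multiplication is commutative
  as soon as the monoid \<open>T\<close> is commutative and \<open>T \<union> {0}\<close> spans additively:
\<close>

lemma spanning_imp_commutative:
  fixes T :: "'a::semiring_1 set" and b c :: 'a
  assumes comm: "\<And>a b. a \<in> T \<Longrightarrow> b \<in> T \<Longrightarrow> a * b = b * a"
    and span: "\<And>b. \<exists>ts. set ts \<subseteq> insert 0 T \<and> b = sum_list ts"
  shows "b * c = c * b"
proof -
  have 1: "a * sum_list ts = sum_list ts * a"
    if "a \<in> insert 0 T" "set ts \<subseteq> insert 0 T" for a ts
    using that(2) by (induction ts) (use that(1) comm in \<open>auto simp: algebra_simps\<close>)
  have 2: "sum_list us * sum_list ts = sum_list ts * sum_list us"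
    if "set us \<subseteq> insert 0 T" "set ts \<subseteq> insert 0 T" for us ts
    using that(1) by (induction us) (use that(2) 1 in \<open>auto simp: algebra_simps\<close>)
  show ?thesis using span[of b] span[of c] 2 by metis
qed

locale semiring_triple =
  fixes T :: "'a::comm_semiring_1 set"
    and A0 :: "'a set"
    and neg :: "'a \<Rightarrow> 'a"
  assumes one_in_T: "1 \<in> T"
    and mult_in_T: "a \<in> T \<Longrightarrow> b \<in> T \<Longrightarrow> a * b \<in> T"
    and zero_notin_T: "0 \<notin> T"
    and T0_spans: "\<exists>ts. set ts \<subseteq> insert 0 T \<and> b = sum_list ts"
    and zero_in_A0: "0 \<in> A0"
    and add_in_A0: "b \<in> A0 \<Longrightarrow> c \<in> A0 \<Longrightarrow> b + c \<in> A0"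
    and T_mult_in_A0: "a \<in> T \<Longrightarrow> b \<in> A0 \<Longrightarrow> a * b \<in> A0"
    and A0_Int_T0: "A0 \<inter> insert 0 T = {0}"
    and neg_zero: "neg 0 = 0"
    and neg_add: "neg (b + c) = neg b + neg c"
    and neg_neg: "neg (neg b) = b"
    and neg_image_T: "neg ` T = T"
    and one_quasi_zero: "1 + neg 1 \<in> A0"
    and neg_mult_left: "a \<in> T \<Longrightarrow> neg a * b = neg (a * b)"
    and neg_mult_right: "a \<in> T \<Longrightarrow> a * neg b = neg (a * b)"

locale regular_semiring_triple = semiring_triple +
  assumes A0_cancel: "a \<in> T \<Longrightarrow> a * b \<in> A0 \<Longrightarrow> b \<in> A0"
    and T_cancel: "a \<in> T \<Longrightarrow> a * b1 = a * b2 \<Longrightarrow> b1 = b2"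
    and property_N: "a1 \<in> T \<Longrightarrow> a2 \<in> T \<Longrightarrow> a1 + a2 \<in> A0 \<Longrightarrow> a1 + a2 = a1 + neg a1"

definition unique_negation :: "'a::comm_semiring_1 set \<Rightarrow> 'a set \<Rightarrow> ('a \<Rightarrow> 'a) \<Rightarrow> bool" where
  "unique_negation T A0 neg \<longleftrightarrow>
     (\<forall>a\<in>T. \<forall>a'\<in>T. a + a' \<in> A0 \<longrightarrow> a' = neg a)"

definition nabla :: "'a::comm_semiring_1 set \<Rightarrow> ('a \<Rightarrow> 'a) \<Rightarrow> 'a \<Rightarrow> 'a \<Rightarrow> bool" where
  "nabla A0 neg b b' \<longleftrightarrow> b + neg b' \<in> A0"

definition nabla_vec :: "'a::comm_semiring_1 set \<Rightarrow> ('a \<Rightarrow> 'a) \<Rightarrow> 'a vec \<Rightarrow> 'a vec \<Rightarrow> bool" where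
  "nabla_vec A0 neg u v \<longleftrightarrow>
     dim_vec u = dim_vec v \<and> (\<forall>i<dim_vec v. nabla A0 neg (u $ i) (v $ i))"

definition T0_vecs :: "'a::comm_semiring_1 set \<Rightarrow> nat \<Rightarrow> 'a vec set" where
  "T0_vecs T n = {w \<in> carrier_vec n. \<forall>i<n. w $ i \<in> insert 0 T}"

definition inverse_in :: "'a::comm_semiring_1 set \<Rightarrow> 'a \<Rightarrow> 'a \<Rightarrow> bool" where
  "inverse_in T a d \<longleftrightarrow> a \<in> T \<and> d \<in> T \<and> a * d = 1"

section \<open>Determinant and adjoint\<close>

text \<open>Only meaningful for square matrices. Rows and columns are numbered from \<open>0\<close>.\<close>

definition ndet :: "('a \<Rightarrow> 'a) \<Rightarrow> 'a::comm_semiring_1 mat \<Rightarrow> 'a" where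
  "ndet neg A = (\<Sum>p | p permutes {0..<dim_row A}.
     (if evenperm p then id else neg) (\<Prod>j\<in>{0..<dim_row A}. A $$ (p j, j)))"

text \<open>\<^term>\<open>mat_delete A j i\<close> deletes row \<open>j\<close> and column \<open>i\<close>.\<close>

definition nadj :: "('a \<Rightarrow> 'a) \<Rightarrow> 'a::comm_semiring_1 mat \<Rightarrow> 'a mat" where
  "nadj neg A = mat (dim_row A) (dim_row A)
     (\<lambda>(i, j). (if even (i + j) then id else neg) (ndet neg (mat_delete A j i)))"

definition singular_mat :: "'a::comm_semiring_1 set \<Rightarrow> ('a \<Rightarrow> 'a) \<Rightarrow> 'a mat \<Rightarrow> bool" where
  "singular_mat A0 neg A \<longleftrightarrow> ndet neg A \<in> A0"

section \<open>Dependence and ranks\<close>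

text \<open>Families \<open>(v i)\<close>, \<open>i \<in> I\<close>, of vectors of length \<open>n\<close>.\<close>

definition dependent_vecs ::
  "'a::comm_semiring_1 set \<Rightarrow> 'a set \<Rightarrow> nat \<Rightarrow> ('i \<Rightarrow> 'a vec) \<Rightarrow> 'i set \<Rightarrow> bool" where
  "dependent_vecs T A0 n v I \<longleftrightarrow>
     (\<exists>I' a. I' \<subseteq> I \<and> finite I' \<and> I' \<noteq> {} \<and> (\<forall>i\<in>I'. a i \<in> T) \<and>
        (\<forall>k<n. (\<Sum>i\<in>I'. a i * v i $ k) \<in> A0))"

text \<open>
  The maxima are over nonempty sets: the empty family is independent, and the empty submatrix has
  determinant \<open>1 \<notin> A0\<close>.
\<close>

definition row_rank :: "'a::comm_semiring_1 set \<Rightarrow> 'a set \<Rightarrow> 'a mat \<Rightarrow> nat" where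
  "row_rank T A0 B =
     Max {card I | I. I \<subseteq> {..<dim_row B} \<and> \<not> dependent_vecs T A0 (dim_col B) (row B) I}"

definition column_rank :: "'a::comm_semiring_1 set \<Rightarrow> 'a set \<Rightarrow> 'a mat \<Rightarrow> nat" where
  "column_rank T A0 B =
     Max {card J | J. J \<subseteq> {..<dim_col B} \<and> \<not> dependent_vecs T A0 (dim_row B) (col B) J}"

definition submatrix_rank :: "'a::comm_semiring_1 set \<Rightarrow> ('a \<Rightarrow> 'a) \<Rightarrow> 'a mat \<Rightarrow> nat" where
  "submatrix_rank A0 neg B =
     Max {card I | I J. I \<subseteq> {..<dim_row B} \<and> J \<subseteq> {..<dim_col B} \<and> card I = card J \<and>
            \<not> singular_mat A0 neg (submatrix B I J)}"

definition condition_A1 :: "'a::comm_semiring_1 set \<Rightarrow> 'a set \<Rightarrow> ('a \<Rightarrow> 'a) \<Rightarrow> bool" where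
  "condition_A1 T A0 neg \<longleftrightarrow>
     (\<forall>B. submatrix_rank A0 neg B \<le> row_rank T A0 B \<and>
          submatrix_rank A0 neg B \<le> column_rank T A0 B)"

end

theory Submission
  imports Defs
begin

text \<open>
  Negation is multiplication by the element \<open>(-)1\<close>, whose square is \<open>1\<close>, and the quasi-zeros \<open>A0\<close>
  form an ideal containing every \<open>b (-) b\<close>. Hence determinants over the triple behave as over a
  ring, with \<open>\<nabla>\<close> in place of equality wherever terms would cancel.

  Necessity. Fix \<open>i\<close> and let \<open>B\<close> be \<open>A\<close> with column \<open>i\<close> replaced by \<open>w\<^sub>i col\<^sub>i(A) (-) v\<close>. By cofactor
  expansion along this column (\<open>ndet_replace_col\<close>), \<open>|B| = |A| w\<^sub>i (-) (adj(A) v)\<^sub>i\<close>, which has to be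
  shown to be in \<open>A0\<close>. The combination of the columns of \<open>B\<close> with coefficient \<open>1\<close> at \<open>i\<close> and \<open>w\<^sub>j\<close>
  elsewhere is \<open>A w (-) v\<close>, so the columns of \<open>B\<close> are dependent. Then the column rank of \<open>B\<close> is below
  its size, and Condition A1 makes \<open>B\<close> singular (\<open>singular_if_dependent_columns\<close>).

  Existence. For every \<open>v\<close>, \<open>A adj(A) v \<nabla> |A| v\<close> (\<open>mult_nadj_nabla\<close>): the diagonal entries of
  \<open>A adj(A)\<close> equal \<open>|A|\<close> by row expansion, and the other entries are determinants with two equal rows,
  whose terms pair off as \<open>b (-) b\<close>. Dividing by \<open>|A|\<close> shows that \<open>x\<close> is a solution.

  Uniqueness. Under unique negation, \<open>\<nabla>\<close> between elements of \<open>T \<union> {0}\<close> is equality, so necessity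
  forces every solution over \<open>T \<union> {0}\<close> to be \<open>x\<close>.
\<close>

section \<open>Signs and quasi-zeros\<close>

context semiring_triple
begin

text \<open>
  The sign as a semiring element, so that signs multiply and move past products by the laws of a
  commutative semiring, without case distinctions between identity and negation.
\<close>

definition sign_if :: "bool \<Rightarrow> 'a" where
  "sign_if P = (if P then 1 else neg 1)"

lemma neg_eq_mult: "neg b = neg 1 * b"
  using neg_mult_left[OF one_in_T, of b] by simp

lemma neg_mult_assoc: "neg (b * c) = neg b * c"
  using neg_eq_mult[of b] neg_eq_mult[of "b * c"] by (simp add: mult.assoc)

lemma neg_mult_commute: "neg (b * c) = b * neg c"
  using neg_mult_assoc[of c b] by (simp add: mult.commute)

lemma neg_sum: "neg (\<Sum>i\<in>I. f i) = (\<Sum>i\<in>I. neg (f i))"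
  by (induction I rule: infinite_finite_induct) (auto simp: neg_zero neg_add)

lemma sign_if_mult: "sign_if P * sign_if Q = sign_if (P = Q)"
  using neg_eq_mult[of "neg 1"] by (auto simp: sign_if_def neg_neg)

lemma sign_if_apply: "(if P then id else neg) b = sign_if P * b"
  using neg_eq_mult[of b] by (auto simp: sign_if_def)

lemma neg_one_in_T: "neg 1 \<in> T"
  using neg_image_T one_in_T by blast

lemma neg_in_T: "a \<in> T \<Longrightarrow> neg a \<in> T"
  using neg_image_T by blast

lemma neg_in_A0: "b \<in> A0 \<Longrightarrow> neg b \<in> A0"
  using T_mult_in_A0[OF neg_one_in_T] neg_eq_mult by metis

lemma sum_in_A0: "(\<And>i. i \<in> I \<Longrightarrow> f i \<in> A0) \<Longrightarrow> (\<Sum>i\<in>I. f i) \<in> A0"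
  by (induction I rule: infinite_finite_induct) (auto simp: zero_in_A0 add_in_A0)

text \<open>
  Elements of \<open>T\<close> and \<open>0\<close> multiply \<open>A0\<close> into itself and generate the semiring additively, so
  \<open>A0\<close> is an ideal of the whole semiring.
\<close>

lemma mult_in_A0:
  assumes "b \<in> A0"
  shows "c * b \<in> A0"
proof -
  obtain ts where ts: "set ts \<subseteq> insert 0 T" "c = sum_list ts"
    using T0_spans by blast
  have "t * b \<in> A0" if "t \<in> insert 0 T" for t
    using that T_mult_in_A0 assms by (auto simp: zero_in_A0)
  then have "sum_list ts * b \<in> A0"
    using ts(1) by (induction ts) (auto simp: distrib_right zero_in_A0 add_in_A0)
  then show ?thesis using ts(2) by simp
qed

lemma add_neg_in_A0: "b + neg b \<in> A0"
proof -
  have "b * (1 + neg 1) = b + neg b"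
    using neg_mult_commute[of b 1] by (simp add: distrib_left)
  then show ?thesis using mult_in_A0[OF one_quasi_zero, of b] by simp
qed

lemma nabla_vec_smult:
  assumes "nabla_vec A0 neg u v"
  shows "nabla_vec A0 neg (c \<cdot>\<^sub>v u) (c \<cdot>\<^sub>v v)"
proof -
  have "c * x + neg (c * y) \<in> A0" if "x + neg y \<in> A0" for x y
    using mult_in_A0[OF that, of c] by (simp add: distrib_left neg_mult_commute)
  then show ?thesis using assms by (auto simp: nabla_vec_def nabla_def)
qed

section \<open>Cofactor expansion\<close>

definition det_term :: "'a mat \<Rightarrow> (nat \<Rightarrow> nat) \<Rightarrow> 'a" where
  "det_term A p = sign_if (evenperm p) * (\<Prod>j\<in>{0..<dim_row A}. A $$ (p j, j))"

lemma ndet_eq_sum_det_term: "ndet neg A = (\<Sum>p | p permutes {0..<dim_row A}. det_term A p)"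
  unfolding ndet_def det_term_def sign_if_apply ..

lemma dim_nadj [simp]:
  "dim_row (nadj neg A) = dim_row A" "dim_col (nadj neg A) = dim_row A"
  by (simp_all add: nadj_def)

lemma nadj_index:
  "i < dim_row A \<Longrightarrow> j < dim_row A \<Longrightarrow>
    nadj neg A $$ (i, j) = sign_if (even (i + j)) * ndet neg (mat_delete A j i)"
  by (simp add: nadj_def sign_if_apply del: even_add)

lemma evenperm_permutation_insert:
  assumes "q permutes {0..<n}" "i < Suc n" "j < Suc n"
  shows "evenperm (permutation_insert i j q) = (even (i + j) = evenperm q)"
proof -
  have "(sign (permutation_insert i j q) :: int) = (-1) ^ (i + j) * sign q"
    using signof_permutation_insert[OF assms, where 'a = int] by simp
  then show ?thesis
    by (cases "even (i + j)") (auto simp: sign_def split: if_splits)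
qed

text \<open>
  A permutation of \<open>n + 1\<close> indices sending \<open>k\<close> to \<open>i\<close> is a permutation of the remaining \<open>n\<close>
  indices with the pair \<open>(k, i)\<close> inserted, which changes its sign by the parity of \<open>k + i\<close>.
  Summing over such permutations, for fixed \<open>k\<close> or for fixed \<open>i\<close>, gives the column and the row
  expansion at once.
\<close>

lemma sum_det_term_fix:
  assumes A: "A \<in> carrier_mat n n" and i: "i < n" and k: "k < n"
  shows "(\<Sum>p | p permutes {0..<n} \<and> p k = i. det_term A p) = A $$ (i, k) * nadj neg A $$ (k, i)"
proof -
  obtain l where n: "n = Suc l" using i by (cases n) auto
  let ?D = "mat_delete A i k"
  have ik: "i < Suc l" "k < Suc l" using i k n by auto
  have D: "dim_row ?D = l" using A n by simp
  \<comment> \<open>\<open>insert_index k\<close> enumerates the columns other than \<open>k\<close>, and \<open>insert_index i\<close> the rows other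
    than \<open>i\<close>; these are the rows and columns of the minor.\<close>
  have step: "det_term A (permutation_insert k i q)
      = A $$ (i, k) * (sign_if (even (k + i)) * det_term ?D q)"
    if q: "q permutes {0..<l}" for q
  proof -
    let ?p = "permutation_insert k i q"
    have p_off: "?p (insert_index k j) = insert_index i (q j)" for j
      unfolding permutation_insert_expand insert_index_def by auto
    have "(\<Prod>j\<in>{0..<n}. A $$ (?p j, j))
        = A $$ (?p k, k) * (\<Prod>j\<in>{0..<n} - {k}. A $$ (?p j, j))"
      using k by (intro prod.remove) auto
    also have "(\<Prod>j\<in>{0..<n} - {k}. A $$ (?p j, j))
        = (\<Prod>j\<in>{0..<l}. A $$ (?p (insert_index k j), insert_index k j))"
      unfolding n insert_index_image[OF ik(2), symmetric]
      by (subst prod.reindex) (auto intro: insert_index_inj_on)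
    also have "\<dots> = (\<Prod>j\<in>{0..<l}. ?D $$ (q j, j))"
    proof (rule prod.cong)
      fix j assume "j \<in> {0..<l}"
      then have j: "j < l" by simp
      then have "q j < l" using permutes_in_image[OF q, of j] by simp
      then show "A $$ (?p (insert_index k j), insert_index k j) = ?D $$ (q j, j)"
        unfolding p_off using mat_delete_index[OF A[unfolded n] ik] j by blast
    qed simp
    finally have "(\<Prod>j\<in>{0..<n}. A $$ (?p j, j)) = A $$ (i, k) * (\<Prod>j\<in>{0..<l}. ?D $$ (q j, j))"
      by simp
    then show ?thesis
      using A D evenperm_permutation_insert[OF q ik(2,1)]
      by (simp add: det_term_def ac_simps sign_if_mult[symmetric] del: even_add)
  qed
  have "(\<Sum>p | p permutes {0..<n} \<and> p k = i. det_term A p)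
      = (\<Sum>q | q permutes {0..<l}. det_term A (permutation_insert k i q))"
    unfolding n permutation_fix[OF ik(2,1)]
    by (subst sum.reindex[OF permutation_insert_inj_on[OF ik(2,1)]]) simp
  also have "\<dots> = A $$ (i, k) * (sign_if (even (k + i)) * ndet neg ?D)"
    unfolding ndet_eq_sum_det_term D sum_distrib_left by (intro sum.cong) (simp_all add: step)
  also have "\<dots> = A $$ (i, k) * nadj neg A $$ (k, i)"
    using A i k by (subst nadj_index) simp_all
  finally show ?thesis .
qed

lemma ndet_column_expansion:
  assumes A: "A \<in> carrier_mat n n" and k: "k < n"
  shows "ndet neg A = (\<Sum>i<n. A $$ (i, k) * nadj neg A $$ (k, i))"
proof -
  let ?P = "{p. p permutes {0..<n}}"
  have "ndet neg A = sum (det_term A) ?P"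
    using A by (simp add: ndet_eq_sum_det_term)
  also have "\<dots> = (\<Sum>i<n. sum (det_term A) {p \<in> ?P. p k = i})"
    using k permutes_in_image[of _ "{0..<n}" k]
    by (intro sum.group[symmetric]) (auto simp: finite_permutations)
  finally show ?thesis
    using sum_det_term_fix[OF A _ k] by simp
qed

lemma ndet_row_expansion:
  assumes A: "A \<in> carrier_mat n n" and i: "i < n"
  shows "ndet neg A = (\<Sum>k<n. A $$ (i, k) * nadj neg A $$ (k, i))"
proof -
  let ?P = "{p. p permutes {0..<n}}"
  have "ndet neg A = sum (det_term A) ?P"
    using A by (simp add: ndet_eq_sum_det_term)
  also have "\<dots> = (\<Sum>k<n. sum (det_term A) {p \<in> ?P. Hilbert_Choice.inv p i = k})"
    using i permutes_in_image[OF permutes_inv, of _ "{0..<n}" i]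
    by (intro sum.group[symmetric]) (auto simp: finite_permutations)
  also have "\<dots> = (\<Sum>k<n. sum (det_term A) {p \<in> ?P. p k = i})"
    by (intro sum.cong) (auto simp: permutes_inverses)
  finally show ?thesis
    using sum_det_term_fix[OF A i] by simp
qed

text \<open>The cofactors of column \<open>i\<close> do not see that column, so replacing it leaves them unchanged.\<close>

lemma ndet_replace_col:
  assumes A: "A \<in> carrier_mat n n" and u: "u \<in> carrier_vec n" and i: "i < n"
  shows "ndet neg (replace_col A u i) = (nadj neg A *\<^sub>v u) $ i"
proof -
  let ?B = "replace_col A u i"
  have B: "?B \<in> carrier_mat n n" using A by (auto simp: replace_col_def)
  have del: "mat_delete ?B r i = mat_delete A r i" if "r < n" for r
    using A that i by (intro eq_matI) (auto simp: mat_delete_def replace_col_def)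
  have "ndet neg ?B = (\<Sum>r<n. nadj neg A $$ (i, r) * u $ r)"
    unfolding ndet_column_expansion[OF B i]
  proof (intro sum.cong)
    fix r assume "r \<in> {..<n}"
    then have r: "r < n" by simp
    have "nadj neg ?B $$ (i, r) = nadj neg A $$ (i, r)"
      using A B i r by (simp add: nadj_index del del: even_add)
    then show "?B $$ (r, i) * nadj neg ?B $$ (i, r) = nadj neg A $$ (i, r) * u $ r"
      using A i r by (simp add: replace_col_def mult.commute)
  qed simp
  then show ?thesis
    using A u i by (simp add: scalar_prod_def atLeast0LessThan)
qed

section \<open>The adjoint produces solutions\<close>

text \<open>
  Composing with the transposition of the two equal rows matches each even permutation with an odd
  one having the same product, so the determinant is a sum of terms \<open>b (-) b\<close>.
\<close>

lemma ndet_identical_rows: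
  assumes A: "A \<in> carrier_mat n n" and ij: "i < n" "j < n" "i \<noteq> j"
    and eq: "\<And>k. k < n \<Longrightarrow> A $$ (i, k) = A $$ (j, k)"
  shows "ndet neg A \<in> A0"
proof -
  let ?t = "Transposition.transpose i j"
  let ?P = "{p. p permutes {0..<n}}"
  let ?E = "{p \<in> ?P. evenperm p}" and ?O = "{p \<in> ?P. \<not> evenperm p}"
  have t: "?t permutes {0..<n}" using ij by (intro permutes_swap_id) auto
  have perm_t: "?t \<circ> p \<in> ?P" if "p \<in> ?P" for p
    using that t by (auto intro: permutes_compose)
  have even_t: "evenperm (?t \<circ> p) = (\<not> evenperm p)" if "p \<in> ?P" for p
  proof -
    have "permutation ?t" "permutation p"
      using that t permutation_permutes by blast+
    then show ?thesis using ij evenperm_comp[of ?t p] evenperm_swap[of i j] by simp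
  qed
  have t_t: "?t \<circ> (?t \<circ> p) = p" for p by (simp add: fun_eq_iff)
  have pair: "det_term A (?t \<circ> p) = neg (det_term A p)" if p: "p \<in> ?E" for p
  proof -
    have "(\<Prod>m\<in>{0..<n}. A $$ ((?t \<circ> p) m, m)) = (\<Prod>m\<in>{0..<n}. A $$ (p m, m))"
      using eq by (intro prod.cong) (auto simp: Transposition.transpose_def)
    then show ?thesis
      using A p even_t[of p] neg_eq_mult[of "\<Prod>m\<in>{0..<n}. A $$ (p m, m)"]
      by (simp add: det_term_def sign_if_def)
  qed
  have "ndet neg A = sum (det_term A) ?E + sum (det_term A) ?O"
    using A by (simp add: ndet_eq_sum_det_term)
      (subst sum.union_disjoint[symmetric]; auto simp: finite_permutations intro!: sum.cong)
  also have "sum (det_term A) ?O = (\<Sum>p\<in>?E. det_term A (?t \<circ> p))"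
    by (rule sum.reindex_bij_witness[where i = "\<lambda>p. ?t \<circ> p" and j = "\<lambda>p. ?t \<circ> p"])
      (use perm_t even_t in \<open>auto simp only: t_t mem_Collect_eq\<close>)
  also have "sum (det_term A) ?E + \<dots> = (\<Sum>p\<in>?E. det_term A p + neg (det_term A p))"
    unfolding sum.distrib[symmetric] by (intro sum.cong) (simp_all add: pair)
  also have "\<dots> \<in> A0" by (intro sum_in_A0 add_neg_in_A0)
  finally show ?thesis .
qed

text \<open>
  Overwriting row \<open>j\<close> by row \<open>i\<close> does not affect the cofactors of row \<open>j\<close>, so the sum is the
  determinant of a matrix with two equal rows.
\<close>

lemma expansion_along_other_row:
  assumes A: "A \<in> carrier_mat n n" and ij: "i < n" "j < n" "i \<noteq> j"
  shows "(\<Sum>k<n. A $$ (i, k) * nadj neg A $$ (k, j)) \<in> A0"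
proof -
  define B where "B = mat n n (\<lambda>(r, c). A $$ (if r = j then i else r, c))"
  have B: "B \<in> carrier_mat n n" by (simp add: B_def)
  have del: "mat_delete B j k = mat_delete A j k" if "k < n" for k
    using A that ij by (intro eq_matI) (auto simp: mat_delete_def B_def)
  have "ndet neg B = (\<Sum>k<n. A $$ (i, k) * nadj neg A $$ (k, j))"
    unfolding ndet_row_expansion[OF B ij(2)]
  proof (intro sum.cong)
    fix k assume "k \<in> {..<n}"
    then have k: "k < n" by simp
    have "nadj neg B $$ (k, j) = nadj neg A $$ (k, j)"
      using A B ij k by (simp add: nadj_index del del: even_add)
    then show "B $$ (j, k) * nadj neg B $$ (k, j) = A $$ (i, k) * nadj neg A $$ (k, j)"
      using ij k by (simp add: B_def)
  qed simp
  moreover have "ndet neg B \<in> A0"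
    using ij by (intro ndet_identical_rows[OF B ij]) (simp add: B_def)
  ultimately show ?thesis by simp
qed

text \<open>
  Over a ring \<open>A adj(A) = |A| I\<close>. Here the diagonal is still exactly \<open>|A|\<close>, while the off-diagonal
  entries are only in the ideal \<open>A0\<close>; hence \<open>\<nabla>\<close> holds for arbitrary \<open>v\<close>.
\<close>

lemma mult_nadj_nabla:
  assumes A: "A \<in> carrier_mat n n" and v: "v \<in> carrier_vec n"
  shows "nabla_vec A0 neg (A *\<^sub>v (nadj neg A *\<^sub>v v)) (ndet neg A \<cdot>\<^sub>v v)"
  unfolding nabla_vec_def nabla_def
proof (intro conjI allI impI)
  fix i assume "i < dim_vec (ndet neg A \<cdot>\<^sub>v v)"
  then have i: "i < n" using v by simp
  define c where "c j = (\<Sum>k<n. A $$ (i, k) * nadj neg A $$ (k, j))" for j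
  have "(A *\<^sub>v (nadj neg A *\<^sub>v v)) $ i
      = (\<Sum>k<n. A $$ (i, k) * (\<Sum>j<n. nadj neg A $$ (k, j) * v $ j))"
    using A v i by (simp add: scalar_prod_def atLeast0LessThan)
  also have "\<dots> = (\<Sum>j<n. c j * v $ j)"
    unfolding c_def sum_distrib_left sum_distrib_right
    by (subst sum.swap) (simp add: mult.assoc)
  also have "\<dots> = c i * v $ i + (\<Sum>j\<in>{..<n} - {i}. c j * v $ j)"
    using i by (intro sum.remove) auto
  also have "c i = ndet neg A"
    unfolding c_def using ndet_row_expansion[OF A i] by simp
  finally have "(A *\<^sub>v (nadj neg A *\<^sub>v v)) $ i + neg ((ndet neg A \<cdot>\<^sub>v v) $ i)
      = (ndet neg A * v $ i + neg (ndet neg A * v $ i)) + (\<Sum>j\<in>{..<n} - {i}. v $ j * c j)"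
    using v i by (simp add: ac_simps)
  also have "\<dots> \<in> A0"
    unfolding c_def
    by (intro add_in_A0 add_neg_in_A0 sum_in_A0 mult_in_A0 expansion_along_other_row[OF A i]) auto
  finally show "(A *\<^sub>v (nadj neg A *\<^sub>v v)) $ i + neg ((ndet neg A \<cdot>\<^sub>v v) $ i) \<in> A0" .
qed (use A v in simp)

section \<open>Condition A1 and necessity\<close>

text \<open>
  Only the full set of columns has \<open>n\<close> elements, so its dependence pushes the column rank below \<open>n\<close>,
  whereas a nonsingular \<open>B\<close>, being a submatrix of itself, would have submatrix rank \<open>n\<close>.
\<close>

lemma singular_if_dependent_columns:
  assumes A1: "condition_A1 T A0 neg" and B: "B \<in> carrier_mat n n"
    and dep: "dependent_vecs T A0 n (col B) {..<n}"
  shows "ndet neg B \<in> A0"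
proof (rule ccontr)
  assume nonsing: "ndet neg B \<notin> A0"
  let ?C = "{card J | J. J \<subseteq> {..<n} \<and> \<not> dependent_vecs T A0 n (col B) J}"
  let ?S = "{card I | I J. I \<subseteq> {..<n} \<and> J \<subseteq> {..<n} \<and> card I = card J \<and>
            \<not> singular_mat A0 neg (submatrix B I J)}"
  have card_le: "card J \<le> n" if "J \<subseteq> {..<n}" for J
    using card_mono[OF _ that] by simp
  have fin: "finite ?C" "finite ?S"
    by (rule finite_subset[of _ "{..n}"]; use card_le in auto)+
  have "\<not> dependent_vecs T A0 n (col B) {}" by (simp add: dependent_vecs_def)
  then have ne: "?C \<noteq> {}" by blast
  have "card J < n" if "J \<subseteq> {..<n}" "\<not> dependent_vecs T A0 n (col B) J" for J
    using that dep card_le[OF that(1)] card_subset_eq[OF _ that(1)]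
    by (cases "card J = n") auto
  then have "Max ?C < n"
    using Max_less_iff[OF fin(1) ne, of n] by blast
  then have col: "column_rank T A0 B < n"
    using B by (simp add: column_rank_def)
  have pick: "pick {..<n} i = i" if "i < n" for i
  proof -
    have "{a \<in> {..<n}. a < i} = {..<i}" using that by auto
    then show ?thesis using pick_card_in_set[of i "{..<n}"] that by simp
  qed
  have "{i. i < n} = {..<n}" by auto
  then have "submatrix B {..<n} {..<n} = B"
    using B pick by (intro eq_matI) (auto simp: submatrix_def)
  then have "n \<in> ?S" using nonsing
    by (intro CollectI exI[of _ "{..<n}"]) (auto simp: singular_mat_def)
  then have "n \<le> submatrix_rank A0 neg B"
    using Max_ge[OF fin(2)] B by (simp add: submatrix_rank_def)
  also have "\<dots> \<le> column_rank T A0 B" using A1 by (simp add: condition_A1_def)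
  finally show False using col by simp
qed

text \<open>
  Multiplying column \<open>i\<close> by \<open>w $ i\<close> and subtracting \<open>v\<close> from it makes the columns dependent, with
  coefficient \<open>1\<close> at \<open>i\<close> and \<open>w $ j\<close> elsewhere: the dependence relation is the hypothesis
  \<open>A w \<nabla> v\<close>. The determinant of the new matrix is \<open>|A| w $ i (-) (adj A v) $ i\<close>. The coefficients
  of a dependence lie in \<open>T\<close>, which is why \<open>w\<close> has entries in \<open>T \<union> {0}\<close>; the columns with
  \<open>w $ j = 0\<close> are left out.
\<close>

lemma solution_nabla_nadj:
  assumes A1: "condition_A1 T A0 neg" and A: "A \<in> carrier_mat n n"
    and v: "v \<in> carrier_vec n" and w: "w \<in> T0_vecs T n"
    and sol: "nabla_vec A0 neg (A *\<^sub>v w) v"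
  shows "nabla_vec A0 neg (ndet neg A \<cdot>\<^sub>v w) (nadj neg A *\<^sub>v v)"
  unfolding nabla_vec_def nabla_def
proof (intro conjI allI impI)
  have wc: "w \<in> carrier_vec n" and wT: "\<And>j. j < n \<Longrightarrow> w $ j \<in> insert 0 T"
    using w by (auto simp: T0_vecs_def)
  show "dim_vec (ndet neg A \<cdot>\<^sub>v w) = dim_vec (nadj neg A *\<^sub>v v)" using A wc by simp
  fix i assume "i < dim_vec (nadj neg A *\<^sub>v v)"
  then have i: "i < n" using A by simp
  define u where "u = vec n (\<lambda>k. w $ i * A $$ (k, i) + neg (v $ k))"
  have u: "u \<in> carrier_vec n" by (simp add: u_def)
  define B where "B = replace_col A u i"
  have B: "B \<in> carrier_mat n n" using A by (auto simp: B_def replace_col_def)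
  define c where "c j = (if j = i then 1 else w $ j)" for j
  define J where "J = {j. j < n \<and> c j \<noteq> 0}"
  have one_neq_zero: "(1::'a) \<noteq> 0" using one_in_T zero_notin_T by metis
  have "dependent_vecs T A0 n (col B) {..<n}"
    unfolding dependent_vecs_def
  proof (intro exI[of _ J] exI[of _ c] conjI allI ballI impI)
    show "J \<noteq> {}" using i one_neq_zero by (auto simp: J_def c_def)
    fix k assume k: "k < n"
    have "(\<Sum>j\<in>J. c j * col B j $ k) = (\<Sum>j<n. c j * B $$ (k, j))"
      using B k by (intro sum.mono_neutral_cong_left) (auto simp: J_def)
    also have "\<dots> = u $ k + (\<Sum>j\<in>{..<n} - {i}. c j * B $$ (k, j))"
      using A i k by (subst sum.remove[of _ i]) (auto simp: c_def B_def replace_col_def)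
    also have "(\<Sum>j\<in>{..<n} - {i}. c j * B $$ (k, j)) = (\<Sum>j\<in>{..<n} - {i}. w $ j * A $$ (k, j))"
      using A k by (intro sum.cong) (auto simp: c_def B_def replace_col_def)
    also have "u $ k + \<dots> = (\<Sum>j<n. w $ j * A $$ (k, j)) + neg (v $ k)"
      using i k by (subst sum.remove[of "{..<n}" i]) (auto simp: u_def ac_simps)
    also have "\<dots> = (A *\<^sub>v w) $ k + neg (v $ k)"
      using A wc k by (simp add: scalar_prod_def atLeast0LessThan mult.commute)
    also have "\<dots> \<in> A0" using sol v k by (auto simp: nabla_vec_def nabla_def)
    finally show "(\<Sum>j\<in>J. c j * col B j $ k) \<in> A0" .
  qed (use wT one_in_T in \<open>auto simp: J_def c_def split: if_splits\<close>)
  then have "ndet neg B \<in> A0" using singular_if_dependent_columns[OF A1 B] by blast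
  also have "ndet neg B = (\<Sum>r<n. nadj neg A $$ (i, r) * u $ r)"
    using ndet_replace_col[OF A u i] A u i
    by (simp add: B_def scalar_prod_def atLeast0LessThan)
  also have "\<dots> = (\<Sum>r<n. w $ i * (A $$ (r, i) * nadj neg A $$ (i, r))
      + neg (nadj neg A $$ (i, r) * v $ r))"
    by (intro sum.cong) (simp_all add: u_def distrib_left neg_mult_commute mult.left_commute
        mult.commute[of "A $$ _"])
  also have "\<dots> = w $ i * ndet neg A + neg (\<Sum>r<n. nadj neg A $$ (i, r) * v $ r)"
    unfolding sum.distrib neg_sum ndet_column_expansion[OF A i] sum_distrib_left ..
  also have "\<dots> = (ndet neg A \<cdot>\<^sub>v w) $ i + neg ((nadj neg A *\<^sub>v v) $ i)"
    using A v wc i by (simp add: scalar_prod_def atLeast0LessThan mult.commute)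
  finally show "(ndet neg A \<cdot>\<^sub>v w) $ i + neg ((nadj neg A *\<^sub>v v) $ i) \<in> A0" .
qed

section \<open>Uniqueness\<close>

text \<open>
  If one of the two elements is \<open>0\<close>, the other lies in \<open>A0 \<inter> (T \<union> {0}) = {0}\<close>; unique negation decides
  the case where both are in \<open>T\<close>.
\<close>

lemma nabla_T0_imp_eq:
  assumes un: "unique_negation T A0 neg" and a: "a \<in> insert 0 T" and b: "b \<in> insert 0 T"
    and "nabla A0 neg a b"
  shows "a = b"
proof -
  have ab: "a + neg b \<in> A0" using assms(4) by (simp add: nabla_def)
  have zero: "c = 0" if "c \<in> A0" "c \<in> insert 0 T" for c
    using that A0_Int_T0 by blast
  consider "a = 0" | "b = 0" | "a \<in> T" "b \<in> T" using a b by blast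
  then show ?thesis
  proof cases
    case 1
    then have "b \<in> A0" using neg_in_A0[OF ab] by (simp add: neg_neg)
    then show ?thesis using zero b 1 by simp
  next
    case 2
    then show ?thesis using zero[of a] ab a by (simp add: neg_zero)
  next
    case 3
    then have "neg b = neg a"
      using un ab neg_in_T unfolding unique_negation_def by blast
    then show ?thesis by (metis neg_neg)
  qed
qed

lemma nabla_T0_vecs_imp_eq:
  assumes "unique_negation T A0 neg" and u: "u \<in> T0_vecs T n" and v: "v \<in> T0_vecs T n"
    and "nabla_vec A0 neg u v"
  shows "u = v"
  using assms nabla_T0_imp_eq[OF assms(1)]
  by (intro eq_vecI) (auto simp: T0_vecs_def nabla_vec_def simp del: insert_iff)

end

theorem theorem11:
  fixes T A0 :: "'a::comm_semiring_1 set"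
    and neg :: "'a \<Rightarrow> 'a"
    and A :: "'a mat"
    and n :: nat
  assumes "regular_semiring_triple T A0 neg"
    and "condition_A1 T A0 neg"
    and "A \<in> carrier_mat n n"
  shows
    "(\<forall>v\<in>carrier_vec n. \<forall>w\<in>T0_vecs T n. nabla_vec A0 neg (A *\<^sub>v w) v \<longrightarrow>
        nabla_vec A0 neg (ndet neg A \<cdot>\<^sub>v w) (nadj neg A *\<^sub>v v)) \<and>
     (\<forall>d. inverse_in T (ndet neg A) d \<longrightarrow>
        (\<forall>v\<in>carrier_vec n.
           let x = d \<cdot>\<^sub>v (nadj neg A *\<^sub>v v) in
             (\<forall>w\<in>T0_vecs T n. nabla_vec A0 neg (A *\<^sub>v w) v \<longrightarrow> nabla_vec A0 neg w x) \<and>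
             (unique_negation T A0 neg \<and> nadj neg A *\<^sub>v v \<in> T0_vecs T n \<longrightarrow>
                {w \<in> T0_vecs T n. nabla_vec A0 neg (A *\<^sub>v w) v} = {x})))"
proof -
  interpret regular_semiring_triple T A0 neg by (fact assms(1))
  note A = assms(3)
  note cramer = solution_nabla_nadj[OF assms(2) A]
  have "(\<forall>w\<in>T0_vecs T n. nabla_vec A0 neg (A *\<^sub>v w) v \<longrightarrow> nabla_vec A0 neg w x) \<and>
      (unique_negation T A0 neg \<and> nadj neg A *\<^sub>v v \<in> T0_vecs T n \<longrightarrow>
         {w \<in> T0_vecs T n. nabla_vec A0 neg (A *\<^sub>v w) v} = {x})"
    if d: "inverse_in T (ndet neg A) d" and v: "v \<in> carrier_vec n"
      and x: "x = d \<cdot>\<^sub>v (nadj neg A *\<^sub>v v)" for d v x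
  proof -
    have dT: "d \<in> T" and d1: "d * ndet neg A = 1"
      using d by (auto simp: inverse_in_def mult.commute)
    have cancel: "d \<cdot>\<^sub>v (ndet neg A \<cdot>\<^sub>v w) = w" for w
      by (intro eq_vecI) (simp_all add: mult.assoc[symmetric] d1)
    have nec: "nabla_vec A0 neg w x"
      if "w \<in> T0_vecs T n" "nabla_vec A0 neg (A *\<^sub>v w) v" for w
      using nabla_vec_smult[OF cramer[OF v that], of d] by (simp add: cancel x)
    have "A *\<^sub>v x = d \<cdot>\<^sub>v (A *\<^sub>v (nadj neg A *\<^sub>v v))"
      using A unfolding x
      by (intro eq_vecI) (simp_all add: scalar_prod_def sum_distrib_left mult.left_commute)
    then have sol: "nabla_vec A0 neg (A *\<^sub>v x) v"
      using nabla_vec_smult[OF mult_nadj_nabla[OF A v], of d] by (simp add: cancel)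
    have "x \<in> T0_vecs T n" if "nadj neg A *\<^sub>v v \<in> T0_vecs T n"
      using that dT A by (auto simp: x T0_vecs_def mult_in_T)
    then show ?thesis
      using nec sol nabla_T0_vecs_imp_eq by blast
  qed
  then show ?thesis using cramer by (simp add: Let_def)
qed

end
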